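(* Let $\mathcal{X}$ be the covariates' domain, $\mathcal{G}$ the space of functions $\mathcal{X}\to\mathbb{R}$ on which a Gaussian process prior for the regression function $g$ is defined, and let $\boldsymbol{b}(\boldsymbol{x}) = (b_1(\boldsymbol{x}),\dots,b_k(\boldsymbol{x}))$ (a row vector) with $b_1,\dots,b_k\in\mathcal{G}$ a linearly independent set of linear functions. Let $\boldsymbol{y}\in\mathbb{R}^n$ be the responses observed at the sample points $\boldsymbol{X}=(\boldsymbol{x}_1,\dots,\boldsymbol{x}_n)'$, $\boldsymbol{x}_i\in\mathcal{X}$, under the Gaussian regression model with variance $\sigma^2>0$ described in the context, so that the posterior is $g(\cdot)\mid\boldsymbol{y},\boldsymbol{X}\sim GP(\mu(\cdot),\Sigma(\cdot,\cdot))$. Fix $\alpha\in(0,1)$ and consider the hypothesis $$H_0:\ g(\boldsymbol{x})=\boldsymbol{b}(\boldsymbol{x})\boldsymbol{\beta}\quad\forall \boldsymbol{x}\in\mathcal{X},\quad \boldsymbol{\beta}\in\mathbb{R}^k,$$ i.e. $H_0$ is the set of functions $\{\boldsymbol{x}\mapsto\boldsymbol{b}(\boldsymbol{x})\boldsymbol{\beta} : \boldsymbol{\beta}\in\mathbb{R}^k\}$. Then: (1) When $\mathcal{X}$ is a finite set, the FBST at level $\alpha$ does not reject $H_0$ if and only if $$\left(\boldsymbol{b}(\mathcal{X})\hat{\boldsymbol{\beta}}-\mu(\mathcal{X})\right)'\Sigma(\mathcal{X},\mathcal{X})^{-1}\left(\boldsymbol{b}(\mathcal{X})\hat{\boldsymbol{\beta}}-\mu(\mathcal{X})\right)\le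 q_{(1-\alpha)}(\chi^2_{|\mathcal{X}|}),$$ where $\hat{\boldsymbol{\beta}}=\left(\boldsymbol{b}(\mathcal{X})'\Sigma(\mathcal{X},\mathcal{X})^{-1}\boldsymbol{b}(\mathcal{X})\right)^{-1}\boldsymbol{b}(\mathcal{X})'\Sigma(\mathcal{X},\mathcal{X})^{-1}\mu(\mathcal{X})$ and $|\mathcal{X}|$ is the size of $\mathcal{X}$. (2) When $\mathcal{X}$ is an infinite set, the FBST at level $\alpha$ does not reject $H_0$ if and only if $$\boldsymbol{y}'\boldsymbol{M}\boldsymbol{y}\le c_\alpha,\qquad \boldsymbol{M}=\mathbb{I}-\boldsymbol{b}(\boldsymbol{X})\left(\boldsymbol{b}(\boldsymbol{X})'\boldsymbol{b}(\boldsymbol{X})\right)^{-1}\boldsymbol{b}(\boldsymbol{X})',$$ where $c_\alpha$ is the constant defining the highest posterior density region in the infinite case, namely the $(1-\alpha)$ quantile of the posterior distribution of the weighted residual sum of squares $WRSS(g)$ defined in the context.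
   Context: Notation. A prime denotes transpose and $\mathbb{I}$ the identity matrix. For a finite list of points $\boldsymbol{Z}=(\boldsymbol{z}_1,\dots,\boldsymbol{z}_m)'$ in $\mathcal{X}$ and a function $h$, $h(\boldsymbol{Z})=(h(\boldsymbol{z}_1),\dots,h(\boldsymbol{z}_m))'\in\mathbb{R}^m$; $\boldsymbol{b}(\boldsymbol{Z})$ is the $m\times k$ matrix with rows $\boldsymbol{b}(\boldsymbol{z}_i)$; for a kernel $K$, $K(\boldsymbol{Z},\boldsymbol{W})$ is the matrix with entries $K(\boldsymbol{z}_i,\boldsymbol{w}_j)$. When $\mathcal{X}$ is finite, $h(\mathcal{X})$, $\boldsymbol{b}(\mathcal{X})$, $\Sigma(\mathcal{X},\mathcal{X})$ are these objects for an enumeration of $\mathcal{X}$. $q_{(1-\alpha)}(\chi^2_m)$ is the $(1-\alpha)$ quantile of the chi-squared distribution with $m$ degrees of freedom. All inverses written are assumed to exist. "Linear functions" is understood in the linear-model sense, so a constant (intercept) function is allowed, e.g. $\boldsymbol{b}(t)=(1,t)$. Model. The prior on $g:\mathcal{X}\to\mathbb{R}$ is a Gaussian process with mean function $m$ and covariance kernel $K$: $g(\boldsymbol{Z})\sim N(m(\boldsymbol{Z}),K(\boldsymbol{Z},\boldsymbol{Z}))$ for every finite $\boldsymbol{Z}\subset\mathcal{X}$. Given $g$, $y_i=g(\boldsymbol{x}_i)+\epsilon_i$ with $\epsilon_i$ i.i.d. $N(0,\sigma^2)$; everything is conditional on $\sigma^2$. The posterior is the Gaussian process $GP(\mu,\Sigma)$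 with $$\mu(\boldsymbol{Z})=m(\boldsymbol{Z})+K(\boldsymbol{Z},\boldsymbol{X})(K(\boldsymbol{X},\boldsymbol{X})+\sigma^2\mathbb{I})^{-1}(\boldsymbol{y}-m(\boldsymbol{X})),$$ $$\Sigma(\boldsymbol{Z},\boldsymbol{Z})=K(\boldsymbol{Z},\boldsymbol{Z})-K(\boldsymbol{Z},\boldsymbol{X})(K(\boldsymbol{X},\boldsymbol{X})+\sigma^2\mathbb{I})^{-1}K(\boldsymbol{X},\boldsymbol{Z}).$$ FBST (Full Bayesian Significance Test). At level $\alpha$, the FBST rejects $H_0$ if and only if $HPD\cap H_0=\emptyset$, where $HPD$ is the $(1-\alpha)100\%$ highest posterior density region, i.e. the superlevel set of the posterior density having posterior probability $1-\alpha$. Concretely: - If $\mathcal{X}$ is finite, the density is the Gaussian density of $g(\mathcal{X})\mid\boldsymbol{y},\boldsymbol{X}$, and $$HPD=\{h:\ (h(\mathcal{X})-\mu(\mathcal{X}))'\Sigma(\mathcal{X},\mathcal{X})^{-1}(h(\mathcal{X})-\mu(\mathcal{X}))\le q_{(1-\alpha)}(\chi^2_{|\mathcal{X}|})\}.$$ - If $\mathcal{X}$ is infinite, the density is the Radon–Nikodym derivative of the posterior law of $g$ with respect to its prior law. Let $\boldsymbol{X}^*$ be the matrix of the distinct rows of $\boldsymbol{X}$, $D_{n_{\boldsymbol{X}^*}}$ the diagonal matrix counting how many times each row of $\boldsymbol{X}^*$ appears in $\boldsymbol{X}$, and $\overline{\boldsymbol{y}}_{\boldsymbol{X}^*}$ the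 vector of means of the entries of $\boldsymbol{y}$ associated with each row of $\boldsymbol{X}^*$. For $h\in\mathcal{G}$ put $$WRSS(h)=(h(\boldsymbol{X}^* )-\overline{\boldsymbol{y}}_{\boldsymbol{X}^*})'D_{n_{\boldsymbol{X}^*}}(h(\boldsymbol{X}^* )-\overline{\boldsymbol{y}}_{\boldsymbol{X}^*}).$$ The derivative at $h$ is proportional to $\exp\left(-\frac{1}{2\sigma^2}WRSS(h)\right)$, and $$HPD=\{h\in\mathcal{G}:\ WRSS(h)\le c_\alpha\},$$ where $c_\alpha$ is the $(1-\alpha)$ quantile of the distribution of $WRSS(g)$ when $g$ is drawn from the posterior $GP(\mu,\Sigma)$ with $\boldsymbol{y},\boldsymbol{X}$ fixed (a generalized chi-squared distribution).
   Formalization: Part (2) as printed fails when repeated sample points have different responses; the criterion y'My ≤ c_α is proved when replicates have equal responses, and for all data with c_α replaced by c_α plus the within-group sum of squares of the responses. *)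

theory Defs
  imports "HOL-Probability.Probability" "Jordan_Normal_Form.Gauss_Jordan_Elimination"
begin

no_notation inner (infix "\<bullet>" 70)
no_notation vec_nth (infixl "$" 90)

section \<open>Functions and kernels evaluated at finite lists of points\<close>

definition eval_at :: "('a \<Rightarrow> real) \<Rightarrow> 'a list \<Rightarrow> real vec" where
  "eval_at h zs = vec_of_list (map h zs)"

definition kernel_mat :: "('a \<Rightarrow> 'a \<Rightarrow> real) \<Rightarrow> 'a list \<Rightarrow> 'a list \<Rightarrow> real mat" where
  "kernel_mat K zs ws = mat (length zs) (length ws) (\<lambda>(i, j). K (zs ! i) (ws ! j))"

definition basis_row :: "nat \<Rightarrow> (nat \<Rightarrow> 'a \<Rightarrow> real) \<Rightarrow> 'a \<Rightarrow> real vec" where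
  "basis_row k b x = vec k (\<lambda>j. b j x)"

definition design_mat :: "nat \<Rightarrow> (nat \<Rightarrow> 'a \<Rightarrow> real) \<Rightarrow> 'a list \<Rightarrow> real mat" where
  "design_mat k b zs = mat_of_rows k (map (basis_row k b) zs)"

text \<open>Meaningful only for invertible arguments; wherever it matters, invertibility is assumed
  or holds automatically.\<close>

definition inv_mat :: "real mat \<Rightarrow> real mat" where
  "inv_mat A = the (mat_inverse A)"

definition quad_form :: "real mat \<Rightarrow> real vec \<Rightarrow> real" where
  "quad_form A v = v \<bullet> (A *\<^sub>v v)"

section \<open>The function space and the linear hypothesis\<close>

text \<open>Functions on the domain \<open>\<X>\<close> are elements of \<open>extensional \<X>\<close>, as in the product measure
  space over \<open>\<X>\<close>; hence the vector space operations have to be restricted to \<open>\<X>\<close>.\<close>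

definition function_space :: "'a set \<Rightarrow> ('a \<Rightarrow> real) set \<Rightarrow> bool" where
  "function_space \<X> \<G> \<longleftrightarrow>
     \<G> \<subseteq> extensional \<X> \<and> (\<lambda>x\<in>\<X>. 0) \<in> \<G> \<and>
     (\<forall>f\<in>\<G>. \<forall>h\<in>\<G>. (\<lambda>x\<in>\<X>. f x + h x) \<in> \<G>) \<and>
     (\<forall>c. \<forall>f\<in>\<G>. (\<lambda>x\<in>\<X>. c * f x) \<in> \<G>)"

text \<open>Linear in the sense of linear models: an intercept is allowed.\<close>

definition linear_function_on :: "'a::real_vector set \<Rightarrow> ('a \<Rightarrow> real) \<Rightarrow> bool" where
  "linear_function_on \<X> f \<longleftrightarrow> (\<exists>c L. linear L \<and> (\<forall>x\<in>\<X>. f x = c + L x))"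

definition linearly_independent_on :: "'a set \<Rightarrow> nat \<Rightarrow> (nat \<Rightarrow> 'a \<Rightarrow> real) \<Rightarrow> bool" where
  "linearly_independent_on \<X> k b \<longleftrightarrow>
     (\<forall>c. (\<forall>x\<in>\<X>. (\<Sum>j<k. c j * b j x) = 0) \<longrightarrow> (\<forall>j<k. c j = 0))"

definition linear_hypothesis :: "'a set \<Rightarrow> nat \<Rightarrow> (nat \<Rightarrow> 'a \<Rightarrow> real) \<Rightarrow> ('a \<Rightarrow> real) set" where
  "linear_hypothesis \<X> k b = {(\<lambda>x\<in>\<X>. basis_row k b x \<bullet> \<beta>) | \<beta>. \<beta> \<in> carrier_vec k}"

section \<open>Gaussian processes and Gaussian process regression\<close>

text \<open>The normal law with mean \<open>m\<close> and variance \<open>v\<close>; for \<open>v = 0\<close> it is the point mass at \<open>m\<close>.\<close>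

definition normal_law :: "real \<Rightarrow> real \<Rightarrow> real measure" where
  "normal_law m v = distr std_normal_distribution borel (\<lambda>z. m + sqrt v * z)"

text \<open>Possibly degenerate multivariate normal distributions, by the usual definition that every
  linear combination of the coordinates is univariate normal.\<close>

definition multivariate_normal ::
    "'w measure \<Rightarrow> nat \<Rightarrow> ('w \<Rightarrow> real vec) \<Rightarrow> real vec \<Rightarrow> real mat \<Rightarrow> bool" where
  "multivariate_normal P n V \<mu> S \<longleftrightarrow>
     (\<forall>a\<in>carrier_vec n. distr P borel (\<lambda>w. a \<bullet> V w) = normal_law (a \<bullet> \<mu>) (quad_form S a))"

definition covariance_kernel :: "'a set \<Rightarrow> ('a \<Rightarrow> 'a \<Rightarrow> real) \<Rightarrow> bool" where
  "covariance_kernel \<X> K \<longleftrightarrow>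
     (\<forall>x\<in>\<X>. \<forall>z\<in>\<X>. K x z = K z x) \<and>
     (\<forall>zs. set zs \<subseteq> \<X> \<longrightarrow> (\<forall>a\<in>carrier_vec (length zs). 0 \<le> quad_form (kernel_mat K zs zs) a))"

text \<open>\<open>P\<close> is the law on \<open>\<G>\<close>, equipped with the sigma-algebra generated by the evaluations at the
  points of \<open>\<X>\<close>, of a Gaussian process with mean function \<open>m\<close> and covariance kernel \<open>K\<close>.\<close>

definition gaussian_process ::
    "'a set \<Rightarrow> ('a \<Rightarrow> real) set \<Rightarrow> ('a \<Rightarrow> real) measure \<Rightarrow> ('a \<Rightarrow> real) \<Rightarrow> ('a \<Rightarrow> 'a \<Rightarrow> real) \<Rightarrow> bool" where
  "gaussian_process \<X> \<G> P m K \<longleftrightarrow>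
     prob_space P \<and>
     sets P = sets (restrict_space (\<Pi>\<^sub>M x\<in>\<X>. borel) \<G>) \<and>
     covariance_kernel \<X> K \<and>
     (\<forall>zs. set zs \<subseteq> \<X> \<longrightarrow>
        multivariate_normal P (length zs) (\<lambda>h. eval_at h zs) (eval_at m zs) (kernel_mat K zs zs))"

text \<open>Density of the responses \<open>y\<close> given \<open>g = h\<close>, where \<open>y\<^sub>i = h x\<^sub>i + \<epsilon>\<^sub>i\<close> with independent
  \<open>\<epsilon>\<^sub>i\<close> normal with mean \<open>0\<close> and variance \<open>\<sigma>\<^sup>2\<close>.\<close>

definition likelihood :: "real \<Rightarrow> 'a list \<Rightarrow> real vec \<Rightarrow> ('a \<Rightarrow> real) \<Rightarrow> real" where
  "likelihood \<sigma> xs y h = (\<Prod>i<length xs. normal_density (h (xs ! i)) \<sigma> (y $ i))"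

definition posterior_law ::
    "('a \<Rightarrow> real) measure \<Rightarrow> real \<Rightarrow> 'a list \<Rightarrow> real vec \<Rightarrow> ('a \<Rightarrow> real) measure" where
  "posterior_law P \<sigma> xs y =
     density P (\<lambda>h. ennreal (likelihood \<sigma> xs y h / (\<integral>h'. likelihood \<sigma> xs y h' \<partial>P)))"

definition noisy_gram :: "('a \<Rightarrow> 'a \<Rightarrow> real) \<Rightarrow> real \<Rightarrow> 'a list \<Rightarrow> real mat" where
  "noisy_gram K \<sigma> xs = kernel_mat K xs xs + \<sigma>\<^sup>2 \<cdot>\<^sub>m 1\<^sub>m (length xs)"

definition posterior_mean ::
    "('a \<Rightarrow> real) \<Rightarrow> ('a \<Rightarrow> 'a \<Rightarrow> real) \<Rightarrow> real \<Rightarrow> 'a list \<Rightarrow> real vec \<Rightarrow> 'a \<Rightarrow> real" where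
  "posterior_mean m K \<sigma> xs y z =
     m z + eval_at (\<lambda>x. K z x) xs \<bullet> (inv_mat (noisy_gram K \<sigma> xs) *\<^sub>v (y - eval_at m xs))"

definition posterior_kernel ::
    "('a \<Rightarrow> 'a \<Rightarrow> real) \<Rightarrow> real \<Rightarrow> 'a list \<Rightarrow> 'a \<Rightarrow> 'a \<Rightarrow> real" where
  "posterior_kernel K \<sigma> xs z w =
     K z w - eval_at (\<lambda>x. K z x) xs \<bullet> (inv_mat (noisy_gram K \<sigma> xs) *\<^sub>v eval_at (\<lambda>x. K x w) xs)"

section \<open>Quantiles\<close>

definition quantile :: "real measure \<Rightarrow> real \<Rightarrow> real" where
  "quantile M p = Inf {t. p \<le> cdf M t}"

definition chi_squared :: "nat \<Rightarrow> real measure" where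
  "chi_squared d = distr (\<Pi>\<^sub>M i\<in>{..<d}. std_normal_distribution) borel (\<lambda>z. \<Sum>i<d. (z i)\<^sup>2)"

section \<open>The weighted residual sum of squares\<close>

text \<open>\<open>remdups xs\<close> lists the distinct sample points.\<close>

definition group_mean :: "'a list \<Rightarrow> real vec \<Rightarrow> 'a \<Rightarrow> real" where
  "group_mean xs y x = (\<Sum>i | i < length xs \<and> xs ! i = x. y $ i) / real (count_list xs x)"

definition wrss :: "'a list \<Rightarrow> real vec \<Rightarrow> ('a \<Rightarrow> real) \<Rightarrow> real" where
  "wrss xs y h =
     (let us = remdups xs
      in quad_form (mat_diag (length us) (\<lambda>i. real (count_list xs (us ! i))))
           (eval_at h us - eval_at (group_mean xs y) us))"

definition wrss_quantile :: "('a \<Rightarrow> real) measure \<Rightarrow> 'a list \<Rightarrow> real vec \<Rightarrow> real \<Rightarrow> real" where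
  "wrss_quantile Q xs y \<alpha> = quantile (distr Q borel (wrss xs y)) (1 - \<alpha>)"

text \<open>Sum of squares of the responses around the means of their groups of replicates.\<close>

definition within_group_ss :: "'a list \<Rightarrow> real vec \<Rightarrow> real" where
  "within_group_ss xs y = (\<Sum>i<length xs. (y $ i - group_mean xs y (xs ! i))\<^sup>2)"

section \<open>Full Bayesian significance test\<close>

text \<open>Here \<open>zs\<close> enumerates a finite domain; the quadratic form does not depend on the order.\<close>

definition hpd_finite ::
    "('a \<Rightarrow> real) set \<Rightarrow> 'a list \<Rightarrow> ('a \<Rightarrow> real) \<Rightarrow> ('a \<Rightarrow> 'a \<Rightarrow> real) \<Rightarrow> real \<Rightarrow> ('a \<Rightarrow> real) set" where
  "hpd_finite \<G> zs \<mu> S \<alpha> =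
     {h \<in> \<G>. quad_form (inv_mat (kernel_mat S zs zs)) (eval_at h zs - eval_at \<mu> zs)
               \<le> quantile (chi_squared (length zs)) (1 - \<alpha>)}"

text \<open>\<open>Q\<close> is the posterior law. The derivative of \<open>Q\<close> with respect to the prior law is a decreasing
  function of \<open>wrss xs y\<close>.\<close>

definition hpd_infinite ::
    "('a \<Rightarrow> real) set \<Rightarrow> ('a \<Rightarrow> real) measure \<Rightarrow> 'a list \<Rightarrow> real vec \<Rightarrow> real \<Rightarrow> ('a \<Rightarrow> real) set" where
  "hpd_infinite \<G> Q xs y \<alpha> = {h \<in> \<G>. wrss xs y h \<le> wrss_quantile Q xs y \<alpha>}"

definition fbst_rejects :: "('a \<Rightarrow> real) set \<Rightarrow> ('a \<Rightarrow> real) set \<Rightarrow> bool" where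
  "fbst_rejects HPD H0 \<longleftrightarrow> HPD \<inter> H0 = {}"

section \<open>Least squares\<close>

definition gls_estimate :: "real mat \<Rightarrow> real mat \<Rightarrow> real vec \<Rightarrow> real vec" where
  "gls_estimate B V v = inv_mat (B\<^sup>T * inv_mat V * B) *\<^sub>v (B\<^sup>T *\<^sub>v (inv_mat V *\<^sub>v v))"

definition residual_maker :: "real mat \<Rightarrow> real mat" where
  "residual_maker B = 1\<^sub>m (dim_row B) - B * inv_mat (B\<^sup>T * B) * B\<^sup>T"

end

(* Both regions are sublevel sets of a nonnegative quadratic form of the deviation of h from a
   target vector, so a linear space of functions meets the region iff the minimiser of the form over
   that space, the generalised least squares fit, lies in it. In the infinite case the ordinary
   residual sum of squares at the sample points is the weighted one plus a term that depends only on
   the responses, so both are minimised by ordinary least squares, where the former equals y'My. *)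

theory Submission
  imports Defs
begin

section \<open>Inverses of matrices and quadratic forms\<close>

text \<open>\<open>inv_mat\<close> unwraps an option with \<open>the\<close>, so its algebraic
  properties become available only once \<open>mat_inverse\<close> is known to succeed.\<close>

lemma inv_mat:
  assumes A: "A \<in> carrier_mat n n" and inv: "invertible_mat A"
  shows "inv_mat A \<in> carrier_mat n n" "A * inv_mat A = 1\<^sub>m n" "inv_mat A * A = 1\<^sub>m n"
proof -
  obtain B where AB: "A * B = 1\<^sub>m (dim_row A)" and BA: "B * A = 1\<^sub>m (dim_row B)"
    using inv unfolding invertible_mat_def inverts_mat_def by auto
  \<comment> \<open>Comparing the numbers of columns on the two sides of each identity forces
    \<open>B\<close> to be square.\<close>
  have "dim_col B = n" "dim_row B = n"
    using arg_cong[OF AB, of dim_col] arg_cong[OF BA, of dim_col] A by auto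
  then have B: "B \<in> carrier_mat n n" by auto
  \<comment> \<open>\<open>mat_inverse\<close> returns \<open>None\<close> only for non-units of the
    matrix ring.\<close>
  have "A \<in> Units (ring_mat TYPE(real) n ())"
    using A B AB BA unfolding Units_def ring_mat_simps by auto
  then obtain C where C: "mat_inverse A = Some C"
    using mat_inverse(1)[OF A, where b="()"] by (cases "mat_inverse A") auto
  then show "inv_mat A \<in> carrier_mat n n" "A * inv_mat A = 1\<^sub>m n" "inv_mat A * A = 1\<^sub>m n"
    using mat_inverse(2)[OF A C] by (auto simp: inv_mat_def)
qed

text \<open>Transposing \<open>A * inv_mat A = 1\<^sub>m n\<close> exhibits the transposed inverse
  as a left inverse of \<open>A\<close>, and a left inverse equals the two-sided one by
  associativity.\<close>

lemma transpose_inv_mat: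
  assumes A: "A \<in> carrier_mat n n" and "invertible_mat A" and sym: "A\<^sup>T = A"
  shows "(inv_mat A)\<^sup>T = inv_mat A"
proof -
  note I = inv_mat[OF assms(1,2)]
  have "(inv_mat A)\<^sup>T * A = 1\<^sub>m n"
    using arg_cong[OF I(2), of transpose_mat] transpose_mult[OF A I(1)] sym by simp
  then have "(inv_mat A)\<^sup>T * A * inv_mat A = inv_mat A"
    using I(1) by simp
  moreover have "(inv_mat A)\<^sup>T * A * inv_mat A = (inv_mat A)\<^sup>T"
    using I A by (simp add: assoc_mult_mat[of _ n n _ n _ n])
  ultimately show ?thesis by simp
qed

text \<open>With w the image of \<open>v\<close> under the inverse, A w = v, so both sides are the
  scalar product of \<open>v\<close> and w. This passes nonnegativity from a covariance matrix to
  its inverse.\<close>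

lemma quad_form_inv_mat:
  assumes A: "A \<in> carrier_mat n n" and "invertible_mat A" and v: "v \<in> carrier_vec n"
  shows "quad_form (inv_mat A) v = quad_form A (inv_mat A *\<^sub>v v)"
proof -
  note I = inv_mat[OF assms(1,2)]
  have w: "inv_mat A *\<^sub>v v \<in> carrier_vec n" using I v by auto
  have "A *\<^sub>v (inv_mat A *\<^sub>v v) = v"
    using assoc_mult_mat_vec[OF A I(1) v] I(2) v by simp
  then show ?thesis
    using comm_scalar_prod[OF v w] by (simp add: quad_form_def)
qed

text \<open>Symmetry of \<open>W\<close> merges the two cross terms into one, which orthogonality
  will later remove.\<close>

lemma quad_form_add:
  assumes W: "W \<in> carrier_mat n n" and sym: "W\<^sup>T = W"
    and u: "u \<in> carrier_vec n" and v: "v \<in> carrier_vec n"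
  shows "quad_form W (u + v) = quad_form W u + quad_form W v + 2 * (v \<bullet> (W *\<^sub>v u))"
proof -
  have Wu: "W *\<^sub>v u \<in> carrier_vec n" and Wv: "W *\<^sub>v v \<in> carrier_vec n" using W u v by auto
  have "u \<bullet> (W *\<^sub>v v) = (W *\<^sub>v u) \<bullet> v"
    using transpose_vec_mult_scalar[OF W v u] sym by simp
  then have "u \<bullet> (W *\<^sub>v v) = v \<bullet> (W *\<^sub>v u)"
    using comm_scalar_prod[OF Wu v] by simp
  then show ?thesis
    using W u v Wu Wv
    by (simp add: quad_form_def mult_add_distrib_mat_vec[OF W u v]
        add_scalar_prod_distrib[of _ n] scalar_prod_add_distrib[of _ n])
qed

lemma quad_form_one:
  assumes "v \<in> carrier_vec n"
  shows "quad_form (1\<^sub>m n) v = (\<Sum>i<n. (v $ i)\<^sup>2)"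
  using assms by (simp add: quad_form_def scalar_prod_def power2_eq_square atLeast0LessThan)

lemma quad_form_mat_diag:
  assumes "v \<in> carrier_vec n"
  shows "quad_form (mat_diag n d) v = (\<Sum>i<n. d i * (v $ i)\<^sup>2)"
proof -
  have "(mat_diag n d *\<^sub>v v) $ i = d i * v $ i" if "i < n" for i
  proof -
    have "(mat_diag n d *\<^sub>v v) $ i = (\<Sum>j<n. (if i = j then d j else 0) * v $ j)"
      using that assms by (simp add: mat_diag_def scalar_prod_def atLeast0LessThan)
    also have "\<dots> = (\<Sum>j<n. if i = j then d j * v $ j else 0)"
      by (intro sum.cong) auto
    finally show ?thesis using that by simp
  qed
  then show ?thesis
    using assms by (simp add: quad_form_def scalar_prod_def power2_eq_square mat_diag_def
        atLeast0LessThan mult_ac)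
qed

section \<open>Weighted least squares\<close>

text \<open>One setting for both cases of the test: \<open>W\<close> is the inverse posterior
  covariance and \<open>v\<close> the posterior mean on a finite domain; \<open>W\<close> is the
  identity and \<open>v\<close> the responses on an infinite one.\<close>

locale weighted_least_squares =
  fixes B W :: "real mat" and n k :: nat and v \<beta> :: "real vec"
  assumes B: "B \<in> carrier_mat n k" and W: "W \<in> carrier_mat n n" and sym: "W\<^sup>T = W"
    and inv: "invertible_mat (B\<^sup>T * W * B)" and v: "v \<in> carrier_vec n"
    and \<beta>_eq: "\<beta> = inv_mat (B\<^sup>T * W * B) *\<^sub>v (B\<^sup>T *\<^sub>v (W *\<^sub>v v))"
begin

lemma estimate_carrier: "\<beta> \<in> carrier_vec k"
  using inv_mat(1)[of "B\<^sup>T * W * B" k] B W v inv unfolding \<beta>_eq by auto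

text \<open>Half the gradient of the quadratic form in the coefficients, which vanishes at the
  estimate.\<close>

lemma normal_equations: "B\<^sup>T *\<^sub>v (W *\<^sub>v (B *\<^sub>v \<beta> - v)) = 0\<^sub>v k"
proof -
  have G: "B\<^sup>T * W * B \<in> carrier_mat k k" and T: "B\<^sup>T \<in> carrier_mat k n" using B W by auto
  have c: "B\<^sup>T *\<^sub>v (W *\<^sub>v v) \<in> carrier_vec k" using B W v by auto
  note I = inv_mat[OF G inv]
  have "(B\<^sup>T * W * B) *\<^sub>v \<beta> = B\<^sup>T *\<^sub>v (W *\<^sub>v v)"
    unfolding \<beta>_eq using assoc_mult_mat_vec[OF G I(1) c] I(2) c by simp
  moreover have "(B\<^sup>T * W * B) *\<^sub>v \<beta> = B\<^sup>T *\<^sub>v (W *\<^sub>v (B *\<^sub>v \<beta>))"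
    using B W T estimate_carrier
    by (simp add: assoc_mult_mat_vec[of _ k n _ k] assoc_mult_mat_vec[of _ k n _ n])
  moreover have "B\<^sup>T *\<^sub>v (W *\<^sub>v (B *\<^sub>v \<beta> - v)) = B\<^sup>T *\<^sub>v (W *\<^sub>v (B *\<^sub>v \<beta>)) - B\<^sup>T *\<^sub>v (W *\<^sub>v v)"
    using B W T estimate_carrier v
    by (simp add: mult_minus_distrib_mat_vec[of _ n n] mult_minus_distrib_mat_vec[of _ k n])
  ultimately show ?thesis using c by simp
qed

text \<open>Moving \<open>B\<close> across the scalar product yields the normal equations: the
  residual is W-orthogonal to the column space of \<open>B\<close>.\<close>

lemma fit_orthogonal_residual:
  assumes "\<gamma> \<in> carrier_vec k"
  shows "(B *\<^sub>v \<gamma>) \<bullet> (W *\<^sub>v (B *\<^sub>v \<beta> - v)) = 0"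
proof -
  have r: "W *\<^sub>v (B *\<^sub>v \<beta> - v) \<in> carrier_vec n" using B W v estimate_carrier by auto
  have "(W *\<^sub>v (B *\<^sub>v \<beta> - v)) \<bullet> (B *\<^sub>v \<gamma>) = 0"
    using transpose_vec_mult_scalar[OF B assms r] normal_equations assms by simp
  then show ?thesis using comm_scalar_prod[OF r, of "B *\<^sub>v \<gamma>"] B assms by auto
qed

text \<open>Pythagoras: replacing \<beta> by \<gamma> adds a vector of the column space to the
  residual, the cross term vanishes, and what is added is nonnegative.\<close>

lemma estimate_minimises:
  assumes psd: "\<And>u. u \<in> carrier_vec n \<Longrightarrow> 0 \<le> quad_form W u" and \<gamma>: "\<gamma> \<in> carrier_vec k"
  shows "quad_form W (B *\<^sub>v \<beta> - v) \<le> quad_form W (B *\<^sub>v \<gamma> - v)"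
proof -
  let ?d = "\<gamma> - \<beta>"
  have d: "?d \<in> carrier_vec k" and Bd: "B *\<^sub>v ?d \<in> carrier_vec n"
    and r: "B *\<^sub>v \<beta> - v \<in> carrier_vec n"
    using B v \<gamma> estimate_carrier by auto
  have "B *\<^sub>v \<gamma> - v = (B *\<^sub>v \<beta> - v) + B *\<^sub>v ?d"
    using B v \<gamma> estimate_carrier mult_minus_distrib_mat_vec[OF B \<gamma> estimate_carrier]
    by (intro eq_vecI) auto
  then have "quad_form W (B *\<^sub>v \<gamma> - v) = quad_form W (B *\<^sub>v \<beta> - v) + quad_form W (B *\<^sub>v ?d)"
    using quad_form_add[OF W sym r Bd] fit_orthogonal_residual[OF d] by simp
  then show ?thesis using psd[OF Bd] by simp
qed

end

text \<open>The residual maker sends \<open>y\<close> to y - B \<beta>. Its product with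
  \<open>y\<close> is the squared length of the residual because the fit is orthogonal to the
  residual.\<close>

lemma quad_form_residual_maker:
  assumes B: "B \<in> carrier_mat n k" and inv: "invertible_mat (B\<^sup>T * B)" and y: "y \<in> carrier_vec n"
    and \<beta>: "\<beta> = inv_mat (B\<^sup>T * B) *\<^sub>v (B\<^sup>T *\<^sub>v y)"
  shows "quad_form (residual_maker B) y = quad_form (1\<^sub>m n) (B *\<^sub>v \<beta> - y)"
proof -
  interpret weighted_least_squares B "1\<^sub>m n" n k y \<beta>
    using assms by unfold_locales auto
  have T: "B\<^sup>T \<in> carrier_mat k n" using B by auto
  have I: "inv_mat (B\<^sup>T * B) \<in> carrier_mat k k" using inv_mat(1)[of _ k] inv B by auto
  have f: "B *\<^sub>v \<beta> \<in> carrier_vec n" using B estimate_carrier by auto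
  have "residual_maker B *\<^sub>v y = y - B *\<^sub>v \<beta>"
    using B I T y unfolding residual_maker_def \<beta>
    by (simp add: minus_mult_distrib_mat_vec[of _ n n] assoc_mult_mat_vec[of _ n k _ n]
        assoc_mult_mat_vec[of _ n k _ k])
  \<comment> \<open>Orthogonality applied to the fit itself.\<close>
  moreover have "(B *\<^sub>v \<beta>) \<bullet> (B *\<^sub>v \<beta>) = (B *\<^sub>v \<beta>) \<bullet> y"
    using fit_orthogonal_residual[OF estimate_carrier] f y
    by (simp add: scalar_prod_minus_distrib[of _ n])
  ultimately show ?thesis
    using f y comm_scalar_prod[OF f y]
    by (simp add: quad_form_def scalar_prod_minus_distrib[of _ n] minus_scalar_prod_distrib[of _ n])
qed

section \<open>Grouping replicated sample points\<close>

lemma card_positions_eq_count_list: "card {i. i < length xs \<and> xs ! i = x} = count_list xs x"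
  by (simp add: count_list_eq_length_filter length_filter_conv_card eq_commute)

lemma sum_positions_by_value:
  "(\<Sum>i<length xs. f i) = (\<Sum>x\<in>set xs. \<Sum>i | i < length xs \<and> xs ! i = x. (f i :: real))"
proof -
  have "(!) xs ` {..<length xs} \<subseteq> set xs" by auto
  then show ?thesis
    using sum.group[OF finite_lessThan finite_set, of "(!) xs" "length xs" xs f] by simp
qed

text \<open>Grouping positions by value counts each distinct point once per occurrence; these
  multiplicities are the diagonal weights in \<open>wrss\<close>.\<close>

lemma sum_positions_eq_sum_remdups:
  "(\<Sum>i<length xs. f (xs ! i)) =
     (\<Sum>j<length (remdups xs). real (count_list xs (remdups xs ! j)) * f (remdups xs ! j))"
proof -
  have "(\<Sum>i<length xs. f (xs ! i)) = (\<Sum>x\<in>set xs. \<Sum>i | i < length xs \<and> xs ! i = x. f x)"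
    unfolding sum_positions_by_value by (intro sum.cong) auto
  also have "\<dots> = (\<Sum>x\<in>set (remdups xs). real (count_list xs x) * f x)"
    by (simp add: card_positions_eq_count_list)
  also have "\<dots> = (\<Sum>j<length (remdups xs). real (count_list xs (remdups xs ! j)) * f (remdups xs ! j))"
    by (rule sum.reindex_bij_betw[symmetric, OF bij_betw_nth]) auto
  finally show ?thesis .
qed

text \<open>Deviations from a mean cancel; membership makes the group size a nonzero
  divisor.\<close>

lemma sum_group_deviations:
  assumes "x \<in> set xs"
  shows "(\<Sum>i | i < length xs \<and> xs ! i = x. y $ i - group_mean xs y x) = 0"
proof -
  have "count_list xs x \<noteq> 0" using assms by (simp add: count_list_0_iff)
  then show ?thesis
    by (simp add: sum_subtractf card_positions_eq_count_list group_mean_def)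
qed

section \<open>Evaluation vectors and the decomposition of the residual sum of squares\<close>

lemma dim_eval_at [simp]: "dim_vec (eval_at h zs) = length zs"
  unfolding eval_at_def by (metis dim_vec_of_list length_map)

lemma eval_at_carrier [simp]: "eval_at h zs \<in> carrier_vec (length zs)"
  by (rule carrier_vecI) (rule dim_eval_at)

lemma eval_at_index [simp]: "i < length zs \<Longrightarrow> eval_at h zs $ i = h (zs ! i)"
  unfolding eval_at_def by (metis vec_of_list_index nth_map)

text \<open>Spreading the weights over the replicates removes them, which makes \<open>wrss\<close>
  comparable with the ordinary residual sum of squares.\<close>

lemma wrss_eq_sum: "wrss xs y h = (\<Sum>i<length xs. (h (xs ! i) - group_mean xs y (xs ! i))\<^sup>2)"
  unfolding sum_positions_eq_sum_remdups[of "\<lambda>x. (h x - group_mean xs y x)\<^sup>2"]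
  by (simp add: wrss_def Let_def quad_form_mat_diag[OF minus_carrier_vec])

text \<open>The analysis of variance identity, obtained by expanding around the group means; the
  second summand does not involve \<open>h\<close>.\<close>

lemma residual_ss_decomposition:
  assumes y: "y \<in> carrier_vec (length xs)"
  shows "quad_form (1\<^sub>m (length xs)) (eval_at h xs - y) = wrss xs y h + within_group_ss xs y"
proof -
  let ?g = "group_mean xs y"
  \<comment> \<open>Within a group the factor containing \<open>h\<close> is constant and comes out
    of the sum, leaving deviations that cancel.\<close>
  have cross: "(\<Sum>i<length xs. (h (xs ! i) - ?g (xs ! i)) * (y $ i - ?g (xs ! i))) = 0"
  proof -
    have "(\<Sum>i<length xs. (h (xs ! i) - ?g (xs ! i)) * (y $ i - ?g (xs ! i))) =
        (\<Sum>x\<in>set xs. \<Sum>i | i < length xs \<and> xs ! i = x. (h x - ?g x) * (y $ i - ?g x))"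
      unfolding sum_positions_by_value by (intro sum.cong) auto
    also have "\<dots> = 0"
      by (rule sum.neutral) (simp add: sum_distrib_left[symmetric] sum_group_deviations)
    finally show ?thesis .
  qed
  have "quad_form (1\<^sub>m (length xs)) (eval_at h xs - y) = (\<Sum>i<length xs. (h (xs ! i) - y $ i)\<^sup>2)"
    using y by (simp add: quad_form_one[OF minus_carrier_vec])
  also have "\<dots> = (\<Sum>i<length xs. (h (xs ! i) - ?g (xs ! i))\<^sup>2 + (y $ i - ?g (xs ! i))\<^sup>2
      - 2 * ((h (xs ! i) - ?g (xs ! i)) * (y $ i - ?g (xs ! i))))"
    by (intro sum.cong refl) (simp add: power2_eq_square algebra_simps)
  also have "\<dots> = wrss xs y h + within_group_ss xs y"
    using cross
    by (simp add: sum.distrib sum_subtractf sum_distrib_left[symmetric] wrss_eq_sum within_group_ss_def)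
  finally show ?thesis .
qed

text \<open>A response that agrees with all its replicates is its own group mean.\<close>

lemma within_group_ss_eq_0:
  assumes const: "\<forall>i<length xs. \<forall>j<length xs. xs ! i = xs ! j \<longrightarrow> y $ i = y $ j"
  shows "within_group_ss xs y = 0"
proof -
  have "y $ i = group_mean xs y (xs ! i)" if i: "i < length xs" for i
  proof -
    have "count_list xs (xs ! i) \<noteq> 0" using i by (simp add: count_list_0_iff)
    moreover have "(\<Sum>j | j < length xs \<and> xs ! j = xs ! i. y $ j) =
        (\<Sum>j | j < length xs \<and> xs ! j = xs ! i. y $ i)"
      by (rule sum.cong[OF refl]) (use const i in blast)
    ultimately show ?thesis
      by (simp add: group_mean_def card_positions_eq_count_list)
  qed
  then show ?thesis by (simp add: within_group_ss_def)
qed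

section \<open>The linear hypothesis\<close>

lemma design_mat_carrier [simp]: "design_mat k b zs \<in> carrier_mat (length zs) k"
  unfolding design_mat_def by (metis length_map mat_of_rows_carrier(1))

text \<open>Turns functions of the hypothesis into elements of the column space of the design
  matrix.\<close>

lemma design_mat_mult_vec:
  assumes "set zs \<subseteq> \<X>"
  shows "design_mat k b zs *\<^sub>v \<beta> = eval_at (\<lambda>x\<in>\<X>. basis_row k b x \<bullet> \<beta>) zs"
proof (intro eq_vecI)
  fix i assume "i < dim_vec (eval_at (\<lambda>x\<in>\<X>. basis_row k b x \<bullet> \<beta>) zs)"
  then have i: "i < length zs" by simp
  then have "zs ! i \<in> \<X>" using assms by auto
  moreover have "row (design_mat k b zs) i = basis_row k b (zs ! i)"
    using i by (simp add: design_mat_def basis_row_def mat_of_rows_row)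
  ultimately show "(design_mat k b zs *\<^sub>v \<beta>) $ i = eval_at (\<lambda>x\<in>\<X>. basis_row k b x \<bullet> \<beta>) zs $ i"
    using i by (simp add: design_mat_def)
qed (simp add: design_mat_def)

text \<open>\<open>function_space\<close> offers only binary sums and scalings, so finite
  combinations are built by induction on the number of basis functions.\<close>

lemma linear_combination_in_function_space:
  fixes k :: nat
  assumes fs: "function_space \<X> \<G>" and b: "\<forall>j<k. b j \<in> \<G>"
  shows "(\<lambda>x\<in>\<X>. \<Sum>j<k. b j x * c j) \<in> \<G>"
  using b
proof (induction k)
  case 0
  have "(\<lambda>x\<in>\<X>. \<Sum>j<0. b j x * c j) = (\<lambda>x\<in>\<X>. 0)"
    by (intro restrict_ext) simp
  then show ?case using fs unfolding function_space_def by metis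
next
  case (Suc k)
  let ?u = "\<lambda>x\<in>\<X>. \<Sum>j<k. b j x * c j" and ?v = "\<lambda>x\<in>\<X>. c k * b k x"
  have "?u \<in> \<G>" by (rule Suc.IH) (use Suc.prems in auto)
  moreover have "?v \<in> \<G>" using Suc.prems fs unfolding function_space_def by blast
  ultimately have "(\<lambda>x\<in>\<X>. ?u x + ?v x) \<in> \<G>" using fs unfolding function_space_def by blast
  moreover have "(\<lambda>x\<in>\<X>. ?u x + ?v x) = (\<lambda>x\<in>\<X>. \<Sum>j<Suc k. b j x * c j)"
    by (intro restrict_ext) simp
  ultimately show ?case by metis
qed

lemma linear_hypothesis_subset:
  assumes "function_space \<X> \<G>" and "\<forall>j<k. b j \<in> \<G>"
  shows "linear_hypothesis \<X> k b \<subseteq> \<G>"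
proof -
  have "(\<lambda>x\<in>\<X>. basis_row k b x \<bullet> \<beta>) \<in> \<G>" if "\<beta> \<in> carrier_vec k" for \<beta>
  proof -
    have "(\<lambda>x\<in>\<X>. basis_row k b x \<bullet> \<beta>) = (\<lambda>x\<in>\<X>. \<Sum>j<k. b j x * \<beta> $ j)"
      using that by (intro restrict_ext) (simp add: basis_row_def scalar_prod_def atLeast0LessThan)
    then show ?thesis using linear_combination_in_function_space[OF assms] by metis
  qed
  then show ?thesis unfolding linear_hypothesis_def by blast
qed

text \<open>As the hypothesis lies inside the function space, meeting a region cut out by
  \<open>R\<close> amounts to finding coefficients.\<close>

lemma not_fbst_rejects_linear_hypothesis:
  assumes "linear_hypothesis \<X> k b \<subseteq> \<G>"
  shows "\<not> fbst_rejects {h \<in> \<G>. R h} (linear_hypothesis \<X> k b) \<longleftrightarrow>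
     (\<exists>\<gamma>\<in>carrier_vec k. R (\<lambda>x\<in>\<X>. basis_row k b x \<bullet> \<gamma>))"
  using assms unfolding fbst_rejects_def linear_hypothesis_def by blast

section \<open>The test on finite and on infinite domains\<close>

lemma fbst_finite:
  assumes sub: "linear_hypothesis \<X> k b \<subseteq> \<G>" and cov: "covariance_kernel \<X> S"
    and zs: "set zs = \<X>" and B_def: "B = design_mat k b zs" and V_def: "V = kernel_mat S zs zs"
    and inv: "invertible_mat V" "invertible_mat (B\<^sup>T * inv_mat V * B)"
    and \<beta>: "\<beta> = gls_estimate B V (eval_at \<mu> zs)"
  shows "\<not> fbst_rejects (hpd_finite \<G> zs \<mu> S \<alpha>) (linear_hypothesis \<X> k b) \<longleftrightarrow>
     quad_form (inv_mat V) (B *\<^sub>v \<beta> - eval_at \<mu> zs) \<le> quantile (chi_squared (length zs)) (1 - \<alpha>)"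
proof -
  let ?n = "length zs"
  have Vc: "V \<in> carrier_mat ?n ?n" by (simp add: V_def kernel_mat_def)
  have S_sym: "S (zs ! i) (zs ! j) = S (zs ! j) (zs ! i)" if "i < ?n" "j < ?n" for i j
    using cov zs that by (metis covariance_kernel_def nth_mem)
  have Vs: "V\<^sup>T = V"
    by (intro eq_matI) (auto simp: V_def kernel_mat_def S_sym)
  \<comment> \<open>The kernel gives nonnegativity for \<open>V\<close>, used here at the image of
    \<open>u\<close> under the inverse.\<close>
  have psd: "0 \<le> quad_form (inv_mat V) u" if u: "u \<in> carrier_vec ?n" for u
    using cov zs quad_form_inv_mat[OF Vc inv(1) u] inv_mat(1)[OF Vc inv(1)] u
    by (auto simp: covariance_kernel_def V_def)
  interpret weighted_least_squares B "inv_mat V" ?n k "eval_at \<mu> zs" \<beta>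
    using inv \<beta> inv_mat(1)[OF Vc inv(1)] transpose_inv_mat[OF Vc inv(1) Vs]
    by unfold_locales (auto simp: B_def gls_estimate_def)
  have fit: "eval_at (\<lambda>x\<in>\<X>. basis_row k b x \<bullet> \<gamma>) zs = B *\<^sub>v \<gamma>" for \<gamma>
    using design_mat_mult_vec[OF equalityD1[OF zs], of k b \<gamma>] by (metis B_def)
  \<comment> \<open>Some coefficients meet the threshold iff the minimising ones do.\<close>
  show ?thesis
    unfolding hpd_finite_def not_fbst_rejects_linear_hypothesis[OF sub] fit V_def[symmetric]
    using estimate_minimises[OF psd] estimate_carrier by (meson order_trans)
qed

text \<open>The bound is on \<open>wrss\<close>, whereas y'My is the full residual sum of squares;
  the gap between them reappears as a shift of the threshold.\<close>

lemma fbst_infinite: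
  assumes sub: "linear_hypothesis \<X> k b \<subseteq> \<G>" and xs: "set xs \<subseteq> \<X>"
    and y: "y \<in> carrier_vec (length xs)"
    and B_def: "B = design_mat k b xs" and BB: "invertible_mat (B\<^sup>T * B)"
  shows "\<not> fbst_rejects (hpd_infinite \<G> Q xs y \<alpha>) (linear_hypothesis \<X> k b) \<longleftrightarrow>
     quad_form (residual_maker B) y \<le> wrss_quantile Q xs y \<alpha> + within_group_ss xs y"
proof -
  let ?n = "length xs" and ?f = "\<lambda>\<gamma>. \<lambda>x\<in>\<X>. basis_row k b x \<bullet> \<gamma>"
  have Bc: "B \<in> carrier_mat ?n k" by (simp add: B_def)
  define \<beta> where "\<beta> = inv_mat (B\<^sup>T * B) *\<^sub>v (B\<^sup>T *\<^sub>v y)"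
  interpret weighted_least_squares B "1\<^sub>m ?n" ?n k y \<beta>
    using Bc BB y by unfold_locales (auto simp: \<beta>_def)
  have psd: "0 \<le> quad_form (1\<^sub>m ?n) u" if "u \<in> carrier_vec ?n" for u
    using that by (simp add: quad_form_one sum_nonneg)
  have ss: "quad_form (1\<^sub>m ?n) (B *\<^sub>v \<gamma> - y) = wrss xs y (?f \<gamma>) + within_group_ss xs y" for \<gamma>
    using residual_ss_decomposition[OF y, of "?f \<gamma>"] design_mat_mult_vec[OF xs, of k b \<gamma>]
    by (metis B_def)
  \<comment> \<open>The within-group sum is added to both sides of the bound, so that ordinary least
    squares applies.\<close>
  have "\<not> fbst_rejects (hpd_infinite \<G> Q xs y \<alpha>) (linear_hypothesis \<X> k b) \<longleftrightarrow>
      (\<exists>\<gamma>\<in>carrier_vec k. quad_form (1\<^sub>m ?n) (B *\<^sub>v \<gamma> - y)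
         \<le> wrss_quantile Q xs y \<alpha> + within_group_ss xs y)"
    unfolding hpd_infinite_def not_fbst_rejects_linear_hypothesis[OF sub] ss by simp
  also have "\<dots> \<longleftrightarrow> quad_form (1\<^sub>m ?n) (B *\<^sub>v \<beta> - y)
         \<le> wrss_quantile Q xs y \<alpha> + within_group_ss xs y"
    using estimate_minimises[OF psd] estimate_carrier by (meson order_trans)
  finally show ?thesis
    by (simp add: quad_form_residual_maker[OF Bc BB y \<beta>_def])
qed

text \<open>On an infinite domain, replicates with different responses add to y'My a variation that
  \<open>wrss\<close> does not see. The plain threshold is therefore stated for responses that agree
  on replicates, in particular for distinct sample points, and the shifted one in general.\<close>

theorem theorem1:
  fixes \<X> :: "'a::real_vector set" and \<G> :: "('a \<Rightarrow> real) set"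
    and b :: "nat \<Rightarrow> 'a \<Rightarrow> real" and k :: nat
    and xs :: "'a list" and y :: "real vec" and \<sigma> \<alpha> :: real
    and m :: "'a \<Rightarrow> real" and K :: "'a \<Rightarrow> 'a \<Rightarrow> real" and P Q :: "('a \<Rightarrow> real) measure"
    and \<mu> :: "'a \<Rightarrow> real" and \<Sigma> :: "'a \<Rightarrow> 'a \<Rightarrow> real" and H0 :: "('a \<Rightarrow> real) set"
  assumes "function_space \<X> \<G>"
    and "\<forall>j<k. b j \<in> \<G> \<and> linear_function_on \<X> (b j)"
    and "linearly_independent_on \<X> k b"
    and "set xs \<subseteq> \<X>" and "y \<in> carrier_vec (length xs)"
    and "\<sigma> > 0" and "0 < \<alpha>" and "\<alpha> < 1"
    and prior: "gaussian_process \<X> \<G> P m K"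
    and Q: "Q = posterior_law P \<sigma> xs y"
    and \<mu>: "\<mu> = posterior_mean m K \<sigma> xs y"
    and \<Sigma>: "\<Sigma> = posterior_kernel K \<sigma> xs"
    and posterior: "gaussian_process \<X> \<G> Q \<mu> \<Sigma>"
    and H0: "H0 = linear_hypothesis \<X> k b"
  shows
    "(finite \<X> \<longrightarrow>
       (\<forall>zs B V \<beta>.
          distinct zs \<and> set zs = \<X> \<and> B = design_mat k b zs \<and> V = kernel_mat \<Sigma> zs zs \<and>
          invertible_mat V \<and> invertible_mat (B\<^sup>T * inv_mat V * B) \<and>
          \<beta> = gls_estimate B V (eval_at \<mu> zs) \<longrightarrow>
          (\<not> fbst_rejects (hpd_finite \<G> zs \<mu> \<Sigma> \<alpha>) H0 \<longleftrightarrow>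
             quad_form (inv_mat V) (B *\<^sub>v \<beta> - eval_at \<mu> zs)
               \<le> quantile (chi_squared (card \<X>)) (1 - \<alpha>)))) \<and>
     (infinite \<X> \<longrightarrow>
       (\<forall>B M. B = design_mat k b xs \<and> invertible_mat (B\<^sup>T * B) \<and> M = residual_maker B \<longrightarrow>
          ((\<forall>i<length xs. \<forall>j<length xs. xs ! i = xs ! j \<longrightarrow> y $ i = y $ j) \<longrightarrow>
             (\<not> fbst_rejects (hpd_infinite \<G> Q xs y \<alpha>) H0 \<longleftrightarrow>
                quad_form M y \<le> wrss_quantile Q xs y \<alpha>)) \<and>
          (\<not> fbst_rejects (hpd_infinite \<G> Q xs y \<alpha>) H0 \<longleftrightarrow>
             quad_form M y \<le> wrss_quantile Q xs y \<alpha> + within_group_ss xs y)))"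
proof -
  have sub: "linear_hypothesis \<X> k b \<subseteq> \<G>"
    using assms(1,2) by (intro linear_hypothesis_subset) auto
  \<comment> \<open>Symmetry and nonnegativity of \<Sigma> come from the posterior being a Gaussian
    process.\<close>
  have cov: "covariance_kernel \<X> \<Sigma>"
    using posterior by (simp add: gaussian_process_def)
  show ?thesis
    unfolding H0
  proof (intro conjI impI allI)
    fix zs B V \<beta>
    assume zs: "distinct zs \<and> set zs = \<X> \<and> B = design_mat k b zs \<and> V = kernel_mat \<Sigma> zs zs \<and>
      invertible_mat V \<and> invertible_mat (B\<^sup>T * inv_mat V * B) \<and>
      \<beta> = gls_estimate B V (eval_at \<mu> zs)"
    \<comment> \<open>Distinctness of the enumeration gives the degrees of freedom.\<close>
    then have card: "length zs = card \<X>" by (metis distinct_card)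
    show "\<not> fbst_rejects (hpd_finite \<G> zs \<mu> \<Sigma> \<alpha>) (linear_hypothesis \<X> k b) \<longleftrightarrow>
        quad_form (inv_mat V) (B *\<^sub>v \<beta> - eval_at \<mu> zs)
          \<le> quantile (chi_squared (card \<X>)) (1 - \<alpha>)"
      using fbst_finite[OF sub cov, of zs B V \<beta> \<mu> \<alpha>, unfolded card] zs by blast
  next
    fix B M
    assume BM: "B = design_mat k b xs \<and> invertible_mat (B\<^sup>T * B) \<and> M = residual_maker B"
    then show iff: "\<not> fbst_rejects (hpd_infinite \<G> Q xs y \<alpha>) (linear_hypothesis \<X> k b) \<longleftrightarrow>
        quad_form M y \<le> wrss_quantile Q xs y \<alpha> + within_group_ss xs y"
      using fbst_infinite[OF sub assms(4,5)] by blast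
    assume "\<forall>i<length xs. \<forall>j<length xs. xs ! i = xs ! j \<longrightarrow> y $ i = y $ j"
    then have "within_group_ss xs y = 0" by (rule within_group_ss_eq_0)
    then show "\<not> fbst_rejects (hpd_infinite \<G> Q xs y \<alpha>) (linear_hypothesis \<X> k b) \<longleftrightarrow>
        quad_form M y \<le> wrss_quantile Q xs y \<alpha>"
      using iff by simp
  qed
qed

end
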